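(* For every real number $\lambda$ with $0<\lambda<1$ and every $z\in\mathbb{C}$, $$\sum_{m=0}^{+\infty}\frac{\lambda^m}{m!}H_{m,m}(z,\overline z)=\frac{1}{1+\lambda}\,e^{\frac{\lambda}{1+\lambda}|z|^2}.$$
   Context: The complex Hermite polynomials $H_{m,n}(z,\overline z)$, $m,n\ge 0$ integers, $z\in\mathbb{C}$ (with $\overline z$ the complex conjugate of $z$), are defined by the generating function $$\sum_{m,n=0}^{+\infty}\frac{u^m}{m!}\frac{v^n}{n!}H_{m,n}(z,\overline z)=e^{-uv+zu+\overline z v},\qquad u,v\in\mathbb{C}.$$ *)

theory Defs
  imports "HOL-Analysis.Analysis"
begin

(* The generating function identity at a fixed z, as an unconditionally convergent
   double series over all pairs (m, n). *)
definition hermite_generating :: "complex \<Rightarrow> (nat \<Rightarrow> nat \<Rightarrow> complex) \<Rightarrow> bool" where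
  "hermite_generating z h \<longleftrightarrow>
     (\<forall>u v :: complex.
        ((\<lambda>(m, n). (u ^ m / fact m) * (v ^ n / fact n) * h m n)
           has_sum exp (- (u * v) + z * u + cnj z * v)) (UNIV :: (nat \<times> nat) set))"

(* complex_hermite m n z is H_{m,n}(z, cnj z). The description is proper: the right-hand
   side is entire in (u, v), so its Taylor expansion gives exactly one coefficient
   family. *)
definition complex_hermite :: "nat \<Rightarrow> nat \<Rightarrow> complex \<Rightarrow> complex" where
  "complex_hermite m n z = (THE h. hermite_generating z h) m n"

end

(* Expanding exp (- u v), exp (z u) and exp (cnj z v) separately and multiplying the three absolutely
   convergent series gives
     H_{m,n} / (m! n!) = sum over k <= min m n of
                           (- 1)^k z^(m - k) (cnj z)^(n - k) / (k! (m - k)! (n - k)!).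
   On the diagonal, with x = |z|^2, the series in question is therefore the double series over
   (j, k) of (- 1)^k (j + k choose j) l^(j + k) x^j / j!, summed along j + k = m. For |l| < 1 it
   converges absolutely, and summing over k first (negative binomial series) leaves
   the exponential series of (l x / (1 + l))^j / j!, divided by 1 + l. *)
theory Submission
  imports Defs
begin

section \<open>Summation\<close>

text \<open>The constant coefficient is the limit of the series at 0. Dividing by \<open>u\<close>
  then shifts the coefficients down, and induction reaches the others. Excluding
  \<open>u = 0\<close> in the assumption keeps it stable under this division.\<close>

lemma powser_eq_0_imp_coeff_0:
  fixes c :: "nat \<Rightarrow> complex"
  assumes "\<And>u. u \<noteq> 0 \<Longrightarrow> (\<lambda>n. c n * u ^ n) sums 0"
  shows "c n = 0"
proof -
  have zeroth: "c 0 = 0" if "\<And>u. u \<noteq> 0 \<Longrightarrow> (\<lambda>n. c n * u ^ n) sums 0" for c :: "nat \<Rightarrow> complex"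
  proof -
    \<comment> \<open>The zero function is the sum of the series off the origin; the radius 1 is an
      arbitrary choice.\<close>
    have "((\<lambda>u::complex. 0::complex) \<longlongrightarrow> c 0) (at 0)"
      by (rule powser_limit_0_strong[of 1]) (use that in auto)
    then show ?thesis
      by (simp add: tendsto_const_iff)
  qed
  show ?thesis
    using assms
  proof (induction n arbitrary: c)
    case 0
    then show ?case
      by (rule zeroth)
  next
    case (Suc n c)
    have "(\<lambda>n. c (Suc n) * u ^ n) sums 0" if "u \<noteq> 0" for u
    proof -
      have "(\<lambda>n. c (Suc n) * u ^ Suc n) sums 0"
        using Suc.prems[OF that] zeroth[OF Suc.prems] by (subst sums_Suc_iff) simp
      then have "(\<lambda>n. (c (Suc n) * u ^ Suc n) / u) sums (0 / u)"
        by (rule sums_divide)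
      then show ?thesis
        using that by simp
    qed
    then show ?case
      by (rule Suc.IH)
  qed
qed

text \<open>For complex families summability is absolute, so Fubini applies once the products of the
  norms are known to be summable over \<open>A \<times> B\<close>.\<close>

lemma has_sum_Times_mult:
  fixes f :: "'a \<Rightarrow> complex" and g :: "'b \<Rightarrow> complex"
  assumes f: "(f has_sum a) A" and g: "(g has_sum b) B"
  shows "((\<lambda>(x, y). f x * g y) has_sum (a * b)) (A \<times> B)"
proof (rule has_sum_SigmaI)
  show "((\<lambda>y. case (x, y) of (x, y) \<Rightarrow> f x * g y) has_sum (f x * b)) B" for x
    using has_sum_cmult_right[OF g] by simp
  show "((\<lambda>x. f x * b) has_sum (a * b)) A"
    by (rule has_sum_cmult_left[OF f])
  have nf: "(\<lambda>x. cmod (f x)) summable_on A" and ng: "(\<lambda>x. cmod (g x)) summable_on B"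
    using f g by (auto simp flip: summable_on_iff_abs_summable_on_complex
        intro: has_sum_imp_summable)
  have "(\<lambda>(x, y). cmod (f x) * cmod (g y)) summable_on (A \<times> B)"
  proof (rule summable_on_SigmaI)
    show "((\<lambda>y. case (x, y) of (x, y) \<Rightarrow> cmod (f x) * cmod (g y)) has_sum
            (cmod (f x) * infsum (\<lambda>y. cmod (g y)) B)) B" for x
      using has_sum_cmult_right[OF has_sum_infsum[OF ng]] by simp
    show "(\<lambda>x. cmod (f x) * infsum (\<lambda>y. cmod (g y)) B) summable_on A"
      by (rule summable_on_cmult_left[OF nf])
  qed auto
  then show "(\<lambda>(x, y). f x * g y) summable_on A \<times> B"
    by (subst summable_on_iff_abs_summable_on_complex) (simp add: case_prod_unfold norm_mult)
qed

lemma exp_has_sum: "((\<lambda>n. w ^ n / fact n) has_sum exp w) UNIV" for w :: complex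
proof (rule norm_summable_imp_has_sum)
  show "summable (\<lambda>n. norm (w ^ n / fact n))"
    using summable_norm_exp[of w] by (simp add: scaleR_conv_of_real field_simps)
  show "(\<lambda>n. w ^ n / fact n) sums exp w"
    using exp_converges[of w] by (simp add: scaleR_conv_of_real field_simps)
qed

text \<open>This is the binomial series for the exponent \<open>- (j + 1)\<close>, with the
  generalized coefficient \<open>(j + k) gchoose k\<close> rewritten by symmetry.\<close>

lemma negative_binomial_sums:
  fixes w :: complex
  assumes "cmod w < 1"
  shows "(\<lambda>k. (- 1) ^ k * of_nat ((j + k) choose j) * w ^ k) sums (1 / (1 + w) ^ Suc j)"
proof -
  have nz: "1 + w \<noteq> 0"
    using assms by (metis add.inverse_inverse add_eq_0_iff norm_minus_cancel norm_one less_irrefl)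
  have "(\<lambda>k. (- 1) ^ k * ((of_nat (Suc j) + of_nat k - 1) gchoose k) * w ^ k) sums
          (1 + w) powr (- of_nat (Suc j))"
    by (rule one_plus_neg_powr_powser[OF assms])
  moreover have "(of_nat (Suc j) + of_nat k - 1) gchoose k = (of_nat ((j + k) choose j) :: complex)" for k
  proof -
    have "(of_nat (Suc j) + of_nat k - 1 :: complex) = of_nat (j + k)"
      by simp
    moreover have "(j + k) choose j = (j + k) choose k"
      by (metis add_diff_cancel_left' binomial_symmetric le_add1)
    ultimately show ?thesis
      by (simp only: binomial_gbinomial)
  qed
  moreover have "(1 + w) powr (- of_nat (Suc j)) = 1 / (1 + w) ^ Suc j"
    using nz powr_nat'[of "1 + w" "Suc j"] by (simp only: powr_minus) (simp add: divide_inverse)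
  ultimately show ?thesis
    by simp
qed

text \<open>Putting \<open>w = - r\<close> in the previous series cancels all signs. The result
  serves as the majorant for absolute convergence.\<close>

lemma negative_binomial_abs_sums:
  fixes r :: real
  assumes "0 \<le> r" "r < 1"
  shows "((\<lambda>k. real ((j + k) choose j) * r ^ k) has_sum (1 / (1 - r) ^ Suc j)) UNIV"
proof (rule sums_nonneg_imp_has_sum)
  have "(\<lambda>k. (- 1) ^ k * of_nat ((j + k) choose j) * (of_real (- r) :: complex) ^ k) sums
          (1 / (1 + of_real (- r)) ^ Suc j)"
    using assms by (intro negative_binomial_sums) simp
  also have "(\<lambda>k. (- 1) ^ k * of_nat ((j + k) choose j) * (of_real (- r) :: complex) ^ k) =
               (\<lambda>k. of_real (real ((j + k) choose j) * r ^ k))"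
    by (rule ext) (simp add: power_minus[of "complex_of_real r"])
  also have "1 / (1 + complex_of_real (- r)) ^ Suc j = of_real (1 / (1 - r) ^ Suc j)"
    by simp
  finally show "(\<lambda>k. real ((j + k) choose j) * r ^ k) sums (1 / (1 - r) ^ Suc j)"
    by (simp only: sums_of_real_iff)
qed (use assms in auto)

section \<open>The explicit form of the complex Hermite polynomials\<close>

text \<open>The difference of the two expansions is a double power series vanishing for all
  \<open>u\<close> and \<open>v\<close>. Comparing coefficients first in \<open>u\<close> with
  \<open>v\<close> fixed, then in \<open>v\<close>, makes every coefficient 0.\<close>

lemma hermite_generating_unique:
  assumes g: "hermite_generating z g" and h: "hermite_generating z h"
  shows "g = h"
proof (intro ext)
  fix m n
  define d where "d m n = (g m n - h m n) / (fact m * fact n)" for m n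
  have d: "((\<lambda>(m, n). (d m n * v ^ n) * u ^ m) has_sum 0) (UNIV \<times> UNIV)" for u v
  proof -
    have "((\<lambda>p. (case p of (m, n) \<Rightarrow> (u ^ m / fact m) * (v ^ n / fact n) * g m n) +
             - (case p of (m, n) \<Rightarrow> (u ^ m / fact m) * (v ^ n / fact n) * h m n)) has_sum
          (exp (- (u * v) + z * u + cnj z * v) + - exp (- (u * v) + z * u + cnj z * v))) UNIV"
      using g h unfolding hermite_generating_def
      by (intro has_sum_add has_sum_uminusI) auto
    moreover have "(u ^ m / fact m) * (v ^ n / fact n) * g m n +
             - ((u ^ m / fact m) * (v ^ n / fact n) * h m n) = (d m n * v ^ n) * u ^ m" for m n
      by (simp add: d_def diff_divide_distrib left_diff_distrib right_diff_distrib mult_ac)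
    ultimately show ?thesis
      by (simp only: case_prod_unfold) simp
  qed
  define w where "w v m = infsum (\<lambda>n. d m n * v ^ n) UNIV" for v m
  have w: "((\<lambda>n. d m n * v ^ n) has_sum w v m) UNIV" for v m
  proof -
    \<comment> \<open>Taking \<open>u = 1\<close> removes the power of \<open>u\<close>, so that
      each row is summable by itself.\<close>
    have "(\<lambda>(m, n). (d m n * v ^ n) * 1 ^ m) summable_on (UNIV \<times> UNIV)"
      using d by (rule has_sum_imp_summable)
    then have "(\<lambda>n. (d m n * v ^ n) * 1 ^ m) summable_on UNIV"
      by (rule summable_on_SigmaD1) simp
    then show ?thesis
      unfolding w_def by simp
  qed
  have "w v m = 0" for v m
  proof (rule powser_eq_0_imp_coeff_0)
    fix u :: complex
    have "((\<lambda>m. w v m * u ^ m) has_sum 0) UNIV"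
      by (rule has_sum_SigmaD[OF d[of v u]]) (use has_sum_cmult_left[OF w] in simp)
    then show "(\<lambda>m. w v m * u ^ m) sums 0"
      by (rule has_sum_imp_sums)
  qed
  then have "(\<lambda>n. d m n * v ^ n) sums 0" for v
    using w[of m v] by (simp add: has_sum_imp_sums)
  then have "d m n = 0"
    by (rule powser_eq_0_imp_coeff_0)
  then show "g m n = h m n"
    by (simp add: d_def)
qed

definition hermite_explicit :: "complex \<Rightarrow> nat \<Rightarrow> nat \<Rightarrow> complex" where
  "hermite_explicit z m n = (\<Sum>k\<le>min m n. (- 1) ^ k * (fact m * fact n) /
     (fact k * fact (m - k) * fact (n - k)) * z ^ (m - k) * cnj z ^ (n - k))"

text \<open>The product of the three exponential series is a triple series over
  \<open>(k, a, b)\<close>. Its terms with \<open>a + k = m\<close> and \<open>b + k = n\<close>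
  carry \<open>u ^ m * v ^ n\<close>, and there are finitely many of them for each
  \<open>(m, n)\<close>.\<close>

lemma hermite_generating_explicit: "hermite_generating z (hermite_explicit z)"
  unfolding hermite_generating_def
proof (intro allI)
  fix u v :: complex
  define t where "t k a b = (- (u * v)) ^ k / fact k * ((z * u) ^ a / fact a * ((cnj z * v) ^ b / fact b))"
    for k a b
  let ?E = "exp (- (u * v) + z * u + cnj z * v)"
  have "((\<lambda>(k, a, b). t k a b) has_sum ?E) (UNIV \<times> UNIV \<times> UNIV)"
    using has_sum_Times_mult[OF exp_has_sum[of "- (u * v)"]
        has_sum_Times_mult[OF exp_has_sum[of "z * u"] exp_has_sum[of "cnj z * v"]]]
    by (simp only: t_def case_prod_unfold exp_add mult.assoc fst_conv snd_conv)
  also have "?this \<longleftrightarrow> ((\<lambda>((m, n), k). t k (m - k) (n - k)) has_sum ?E)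
                   (SIGMA (m, n):UNIV. {..min m n})"
    by (rule has_sum_reindex_bij_witness[where i = "\<lambda>((m, n), k). (k, m - k, n - k)"
          and j = "\<lambda>(k, a, b). ((a + k, b + k), k)"]) auto
  finally have S: "((\<lambda>((m, n), k). t k (m - k) (n - k)) has_sum ?E)
                   (SIGMA (m, n):UNIV. {..min m n})" .
  have "((\<lambda>k. t k (m - k) (n - k)) has_sum
      (u ^ m / fact m) * (v ^ n / fact n) * hermite_explicit z m n) {..min m n}" for m n
  proof (rule has_sum_finiteI)
    show "(u ^ m / fact m) * (v ^ n / fact n) * hermite_explicit z m n =
            (\<Sum>k\<le>min m n. t k (m - k) (n - k))"
      unfolding hermite_explicit_def sum_distrib_left
    proof (rule sum.cong[OF refl])
      fix k assume "k \<in> {..min m n}"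
      \<comment> \<open>The bound \<open>k \<le> min m n\<close> makes both truncated subtractions
        genuine.\<close>
      then have "u ^ m = u ^ k * u ^ (m - k)" "v ^ n = v ^ k * v ^ (n - k)"
        by (simp_all flip: power_add)
      then show "u ^ m / fact m * (v ^ n / fact n) * ((- 1) ^ k * (fact m * fact n) /
          (fact k * fact (m - k) * fact (n - k)) * z ^ (m - k) * cnj z ^ (n - k)) =
          t k (m - k) (n - k)"
        by (simp add: t_def power_mult_distrib power_minus[of "u * v"] mult_ac)
    qed
  qed simp
  then show "((\<lambda>(m, n). (u ^ m / fact m) * (v ^ n / fact n) * hermite_explicit z m n) has_sum ?E) UNIV"
    by (intro has_sum_SigmaD[OF S]) auto
qed

lemma complex_hermite_explicit: "complex_hermite m n z = hermite_explicit z m n"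
proof -
  have "(THE h. hermite_generating z h) = hermite_explicit z"
    by (intro the_equality hermite_generating_explicit
        hermite_generating_unique[OF _ hermite_generating_explicit])
  then show ?thesis
    by (simp add: complex_hermite_def)
qed

section \<open>The diagonal series\<close>

lemma negative_binomial_exp_has_sum:
  fixes w x :: complex
  assumes w: "cmod w < 1"
  shows "((\<lambda>(j, k). (- 1) ^ k * of_nat ((j + k) choose j) * w ^ (j + k) * (x ^ j / fact j))
           has_sum (1 / (1 + w) * exp (w / (1 + w) * x))) (UNIV \<times> UNIV)"
    (is "(?f has_sum _) _")
proof (rule has_sum_SigmaI)
  have r: "((\<lambda>k. real ((j + k) choose j) * cmod w ^ k) has_sum (1 / (1 - cmod w) ^ Suc j)) UNIV" for j
    using w by (intro negative_binomial_abs_sums) auto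
  show "((\<lambda>k. ?f (j, k)) has_sum (1 / (1 + w) * ((w / (1 + w) * x) ^ j / fact j))) UNIV" for j
  proof -
    have "((\<lambda>k. (- 1) ^ k * of_nat ((j + k) choose j) * w ^ k) has_sum (1 / (1 + w) ^ Suc j)) UNIV"
    proof (rule norm_summable_imp_has_sum)
      show "summable (\<lambda>k. norm ((- 1) ^ k * of_nat ((j + k) choose j) * w ^ k))"
        using has_sum_imp_sums[OF r[of j]] by (simp add: norm_mult norm_power sums_iff)
    qed (rule negative_binomial_sums[OF w])
    from has_sum_cmult_right[OF this, of "w ^ j * (x ^ j / fact j)"] show ?thesis
      by (simp add: power_add power_mult_distrib power_divide mult_ac)
  qed
  show "((\<lambda>j. 1 / (1 + w) * ((w / (1 + w) * x) ^ j / fact j)) has_sum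
          (1 / (1 + w) * exp (w / (1 + w) * x))) UNIV"
    by (rule has_sum_cmult_right[OF exp_has_sum])
  have "(\<lambda>p. cmod (?f p)) summable_on (UNIV \<times> UNIV)"
  proof (rule summable_on_SigmaI)
    \<comment> \<open>Summing the norms over \<open>k\<close> gives \<open>1 / (1 - cmod w)\<close>
      times the j-th term of the exponential series of \<open>?y\<close>.\<close>
    let ?y = "cmod w * cmod x / (1 - cmod w)"
    show "((\<lambda>k. cmod (?f (j, k))) has_sum (1 / (1 - cmod w) * (?y ^ j / fact j))) UNIV" for j
      using has_sum_cmult_right[OF r[of j], of "cmod w ^ j * (cmod x ^ j / fact j)"]
      by (simp add: norm_mult norm_divide norm_power power_add power_mult_distrib power_divide mult_ac)
    have "summable (\<lambda>j. norm (?y ^ j / fact j))"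
      using summable_norm_exp[of ?y] by (simp add: field_simps)
    then have "(\<lambda>j. ?y ^ j / fact j) summable_on UNIV"
      by (rule norm_summable_imp_summable_on)
    then show "(\<lambda>j. 1 / (1 - cmod w) * (?y ^ j / fact j)) summable_on UNIV"
      by (rule summable_on_cmult_right)
  qed auto
  then show "?f summable_on UNIV \<times> UNIV"
    by (subst summable_on_iff_abs_summable_on_complex)
qed

text \<open>The substitution \<open>j = m - k\<close> makes the exponent of \<open>z * cnj z\<close>
  the summation index, which matches the antidiagonals of the double series above.\<close>

lemma hermite_explicit_diagonal:
  "w ^ m / fact m * hermite_explicit z m m =
     (\<Sum>j\<le>m. (- 1) ^ (m - j) * of_nat (m choose j) * w ^ m * ((z * cnj z) ^ j / fact j))"
proof -
  have "w ^ m / fact m * hermite_explicit z m m =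
          (\<Sum>k\<le>m. (- 1) ^ k * (fact m / (fact k * fact (m - k))) * w ^ m *
             ((z * cnj z) ^ (m - k) / fact (m - k)))"
    unfolding hermite_explicit_def sum_distrib_left
    by (intro sum.cong) (auto simp: power_mult_distrib)
  also have "\<dots> = (\<Sum>j\<le>m. (- 1) ^ (m - j) * (fact m / (fact j * fact (m - j))) * w ^ m *
             ((z * cnj z) ^ j / fact j))"
    by (rule sum.reindex_bij_witness[where i = "\<lambda>j. m - j" and j = "\<lambda>j. m - j"])
       (auto simp: mult.commute)
  also have "\<dots> = (\<Sum>j\<le>m. (- 1) ^ (m - j) * of_nat (m choose j) * w ^ m *
             ((z * cnj z) ^ j / fact j))"
    by (intro sum.cong) (auto simp: binomial_fact)
  finally show ?thesis .
qed

lemma complex_hermite_diagonal_sums: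
  assumes w: "cmod w < 1"
  shows "(\<lambda>m. w ^ m / fact m * complex_hermite m m z) sums
           (1 / (1 + w) * exp (w / (1 + w) * (z * cnj z)))"
proof -
  let ?S = "1 / (1 + w) * exp (w / (1 + w) * (z * cnj z))"
  define f where "f j k = (- 1) ^ k * of_nat ((j + k) choose j) * w ^ (j + k) *
      ((z * cnj z) ^ j / fact j)" for j k
  have "((\<lambda>(j, k). f j k) has_sum ?S) (UNIV \<times> UNIV)"
    unfolding f_def by (rule negative_binomial_exp_has_sum[OF w])
  \<comment> \<open>Absolute convergence permits regrouping along \<open>j + k = m\<close>; each
    group is finite and sums to the m-th diagonal term.\<close>
  also have "?this \<longleftrightarrow> ((\<lambda>(m, j). f j (m - j)) has_sum ?S) (SIGMA m:UNIV. {..m})"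
    by (rule has_sum_reindex_bij_witness[where i = "\<lambda>(m, j). (j, m - j)"
          and j = "\<lambda>(j, k). (j + k, j)"]) auto
  finally have "((\<lambda>m. w ^ m / fact m * complex_hermite m m z) has_sum ?S) UNIV"
    by (rule has_sum_SigmaD)
       (auto intro!: has_sum_finiteI sum.cong
          simp: complex_hermite_explicit hermite_explicit_diagonal f_def simp del: times_divide_eq_left)
  then show ?thesis
    by (rule has_sum_imp_sums)
qed

theorem theorem4p6:
  fixes l :: real and z :: complex
  assumes "0 < l" and "l < 1"
  shows "(\<lambda>m. (complex_of_real l ^ m / fact m) * complex_hermite m m z) sums
           complex_of_real (1 / (1 + l) * exp (l / (1 + l) * (cmod z)\<^sup>2))"
proof -
  have "(\<lambda>m. complex_of_real l ^ m / fact m * complex_hermite m m z) sums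
          (1 / (1 + of_real l) * exp (of_real l / (1 + of_real l) * (z * cnj z)))"
    using assms by (intro complex_hermite_diagonal_sums) simp
  moreover have "1 / (1 + of_real l) * exp (of_real l / (1 + of_real l) * (z * cnj z)) =
      complex_of_real (1 / (1 + l) * exp (l / (1 + l) * (cmod z)\<^sup>2))"
    by (simp only: complex_norm_square[symmetric] of_real_add of_real_mult of_real_divide
        of_real_1 exp_of_real[symmetric])
  ultimately show ?thesis
    by (simp only:)
qed

end
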